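(* Let $(S,* )$ be an adequate partial semigroup. Consider the statements: (1) $CR(S)\neq\emptyset$; (2) every piecewise syndetic subset of $S$ is a CR set; (3) for every $k\in\mathbb{N}$, every piecewise syndetic subset of $S$ is a $k$-CR set; (4) $S$ is a CR set in $S$, and whenever $A_1,A_2\subseteq S$ and $A_1\cup A_2$ is a CR set, either $A_1$ or $A_2$ is a CR set. Then (1), (2) and (3) are equivalent, and (4) implies (1).
   Context: A partial semigroup is a pair $(S,* )$ where $S$ is a nonempty set and $*$ is an operation defined on a nonempty subset of $S\times S$ such that for all $x,y,z\in S$, $(x*y)*z=x*(y*z)$ in the sense that if either side is defined then so is the other and they are equal. For $a\in S$, $\varphi(a)=\{b\in S: a*b \text{ is defined}\}$; for finite nonempty $F\subseteq S$, $\sigma(F)=\bigcap_{a\in F}\varphi(a)$. $(S,* )$ is adequate if $\sigma(F)\neq\emptyset$ for all finite nonempty $F$. $\mathcal{P}_f(X)$ denotes the set of finite nonempty subsets of $X$. Products $\prod_{t\in H}f(t)$ are computed in increasing order of indices. A sequence $f:\mathbb{N}\to S$ is adequate if (i) for each $H\in\mathcal{P}_f(\mathbb{N})$, $\prod_{t\in H}f(t)$ is defined, and (ii) for each $F\in\mathcal{P}_f(S)$ there is $m\in\mathbb{N}$ such that $\prod_{t\in H}f(t)\in\sigma(F)$ for all $H\in\mathcal{P}_f(\mathbb{N})$ with $\min H\geq m$. $\mathcal{T}$ denotes the set of adequate sequences, and $\mathcal{P}_f(\mathcal{T})_{\leq k}=\{F\in\mathcal{P}_f(\mathcal{T}): |F|\leq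 k\}$. For $k\in\mathbb{N}$, $A\subseteq S$ is a $k$-CR set if for every $L\in\mathcal{P}_f(S)$ there is $r\in\mathbb{N}$ such that for every $F\in\mathcal{P}_f(\mathcal{T})_{\leq k}$ there exist $m\in\mathbb{N}$, $a\in S^{m+1}$ and $t(1)<\dots<t(m)\leq r$ in $\mathbb{N}$ such that for all $f\in F$, $a(1)*f(t(1))*a(2)*\dots*a(m)*f(t(m))*a(m+1)$ is defined and lies in $A\cap\sigma(L)$; $A$ is a CR set if it is $k$-CR for all $k$. $\beta S$ is the set of ultrafilters on $S$, $\overline{A}=\{p\in\beta S:A\in p\}$, $\delta S=\bigcap_{F\in\mathcal{P}_f(S)}\overline{\sigma(F)}$, $x^{-1}A=\{y\in\varphi(x):x*y\in A\}$, and for $p,q\in\delta S$, $p*q=\{A\subseteq S:\{x\in S:x^{-1}A\in q\}\in p\}$; this makes $\delta S$ a compact Hausdorff right topological semigroup with smallest two-sided ideal $K(\delta S)$. $A$ is piecewise syndetic if $\overline{A}\cap K(\delta S)\neq\emptyset$. $CR(S)=\{p\in\delta S:\text{every } A\in p\text{ is a CR set}\}$. *)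

theory Defs
  imports Main "HOL-Library.FuncSet"
begin

text \<open>
  The positive integers are written \<open>{1..} :: nat set\<close>. A partial operation on \<open>S\<close> is a function
  \<open>mul :: 'a \<Rightarrow> 'a \<Rightarrow> 'a option\<close>, with \<open>None\<close> for ``undefined''.
\<close>

definition finite_nonempty_subsets :: "'a set \<Rightarrow> 'a set set" (\<open>\<P>\<^sub>f\<close>) where
  "\<P>\<^sub>f X = {F. F \<subseteq> X \<and> finite F \<and> F \<noteq> {}}"

text \<open>
  In the associativity law, a bind is \<open>None\<close> as soon as the inner or the outer product is undefined,
  so the equation says that one side is defined iff the other one is, and that they then agree.
\<close>

definition partial_semigroup :: "'a set \<Rightarrow> ('a \<Rightarrow> 'a \<Rightarrow> 'a option) \<Rightarrow> bool" where
  "partial_semigroup S mul \<longleftrightarrow>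
     S \<noteq> {} \<and>
     (\<forall>x y z. mul x y = Some z \<longrightarrow> x \<in> S \<and> y \<in> S \<and> z \<in> S) \<and>
     (\<exists>x\<in>S. \<exists>y\<in>S. mul x y \<noteq> None) \<and>
     (\<forall>x\<in>S. \<forall>y\<in>S. \<forall>z\<in>S.
        Option.bind (mul x y) (\<lambda>u. mul u z) = Option.bind (mul y z) (\<lambda>v. mul x v))"

definition phi :: "'a set \<Rightarrow> ('a \<Rightarrow> 'a \<Rightarrow> 'a option) \<Rightarrow> 'a \<Rightarrow> 'a set" where
  "phi S mul a = {b \<in> S. mul a b \<noteq> None}"

definition sigma :: "'a set \<Rightarrow> ('a \<Rightarrow> 'a \<Rightarrow> 'a option) \<Rightarrow> 'a set \<Rightarrow> 'a set" where
  "sigma S mul F = (\<Inter>a\<in>F. phi S mul a)"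

definition adequate_partial_semigroup :: "'a set \<Rightarrow> ('a \<Rightarrow> 'a \<Rightarrow> 'a option) \<Rightarrow> bool" where
  "adequate_partial_semigroup S mul \<longleftrightarrow>
     partial_semigroup S mul \<and> (\<forall>F\<in>\<P>\<^sub>f S. sigma S mul F \<noteq> {})"

text \<open>
  The product of a nonempty word. By associativity the bracketing affects neither whether it is
  defined nor its value. The empty word has no product.
\<close>

fun word_prod :: "('a \<Rightarrow> 'a \<Rightarrow> 'a option) \<Rightarrow> 'a list \<Rightarrow> 'a option" where
  "word_prod mul [] = None"
| "word_prod mul [x] = Some x"
| "word_prod mul (x # y # ys) = Option.bind (word_prod mul (y # ys)) (mul x)"

definition set_prod :: "('a \<Rightarrow> 'a \<Rightarrow> 'a option) \<Rightarrow> (nat \<Rightarrow> 'a) \<Rightarrow> nat set \<Rightarrow> 'a option" where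
  "set_prod mul f H = word_prod mul (map f (sorted_list_of_set H))"

text \<open>
  Sequences are extensional functions on the positive integers, so that distinct members of
  \<open>adequate_seqs\<close> are distinct sequences and cardinalities of sets of sequences are as intended.
\<close>

definition adequate_seqs :: "'a set \<Rightarrow> ('a \<Rightarrow> 'a \<Rightarrow> 'a option) \<Rightarrow> (nat \<Rightarrow> 'a) set" where
  "adequate_seqs S mul =
     {f \<in> {1..} \<rightarrow>\<^sub>E S.
        (\<forall>H\<in>\<P>\<^sub>f {1..}. set_prod mul f H \<noteq> None) \<and>
        (\<forall>F\<in>\<P>\<^sub>f S. \<exists>m\<ge>1. \<forall>H\<in>\<P>\<^sub>f {1..}. Min H \<ge> m \<longrightarrow>
           (\<exists>y\<in>sigma S mul F. set_prod mul f H = Some y))}"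

text \<open>The word \<open>a 1, f (t 1), a 2, \<dots>, a m, f (t m), a (m + 1)\<close>.\<close>

definition interleave :: "nat \<Rightarrow> (nat \<Rightarrow> 'a) \<Rightarrow> (nat \<Rightarrow> nat) \<Rightarrow> (nat \<Rightarrow> 'a) \<Rightarrow> 'a list" where
  "interleave m a t f = concat (map (\<lambda>i. [a i, f (t i)]) [1..<m + 1]) @ [a (m + 1)]"

definition k_CR :: "'a set \<Rightarrow> ('a \<Rightarrow> 'a \<Rightarrow> 'a option) \<Rightarrow> nat \<Rightarrow> 'a set \<Rightarrow> bool" where
  "k_CR S mul k A \<longleftrightarrow>
     A \<subseteq> S \<and>
     (\<forall>L\<in>\<P>\<^sub>f S. \<exists>r\<ge>1. \<forall>F\<in>\<P>\<^sub>f (adequate_seqs S mul). card F \<le> k \<longrightarrow>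
        (\<exists>m\<ge>1. \<exists>a \<in> {1..m + 1} \<rightarrow>\<^sub>E S. \<exists>t.
           strict_mono_on {1..m} t \<and> t ` {1..m} \<subseteq> {1..r} \<and>
           (\<forall>f\<in>F. \<exists>y \<in> A \<inter> sigma S mul L. word_prod mul (interleave m a t f) = Some y)))"

definition CR_set :: "'a set \<Rightarrow> ('a \<Rightarrow> 'a \<Rightarrow> 'a option) \<Rightarrow> 'a set \<Rightarrow> bool" where
  "CR_set S mul A \<longleftrightarrow> (\<forall>k\<ge>1. k_CR S mul k A)"

definition beta :: "'a set \<Rightarrow> 'a set set set" where
  "beta S =
     {p. p \<subseteq> Pow S \<and> S \<in> p \<and> {} \<notin> p \<and>
         (\<forall>A\<in>p. \<forall>B\<in>p. A \<inter> B \<in> p) \<and>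
         (\<forall>A\<in>p. \<forall>B. A \<subseteq> B \<and> B \<subseteq> S \<longrightarrow> B \<in> p) \<and>
         (\<forall>A. A \<subseteq> S \<longrightarrow> A \<in> p \<or> S - A \<in> p)}"

definition beta_closure :: "'a set \<Rightarrow> 'a set \<Rightarrow> 'a set set set" where
  "beta_closure S A = {p \<in> beta S. A \<in> p}"

definition delta :: "'a set \<Rightarrow> ('a \<Rightarrow> 'a \<Rightarrow> 'a option) \<Rightarrow> 'a set set set" where
  "delta S mul = (\<Inter>F\<in>\<P>\<^sub>f S. beta_closure S (sigma S mul F))"

definition left_quotient ::
    "'a set \<Rightarrow> ('a \<Rightarrow> 'a \<Rightarrow> 'a option) \<Rightarrow> 'a \<Rightarrow> 'a set \<Rightarrow> 'a set" where
  "left_quotient S mul x A = {y \<in> phi S mul x. the (mul x y) \<in> A}"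

definition delta_mult ::
    "'a set \<Rightarrow> ('a \<Rightarrow> 'a \<Rightarrow> 'a option) \<Rightarrow> 'a set set \<Rightarrow> 'a set set \<Rightarrow> 'a set set" where
  "delta_mult S mul p q = {A. A \<subseteq> S \<and> {x \<in> S. left_quotient S mul x A \<in> q} \<in> p}"

definition two_sided_ideal ::
    "'a set \<Rightarrow> ('a \<Rightarrow> 'a \<Rightarrow> 'a option) \<Rightarrow> 'a set set set \<Rightarrow> bool" where
  "two_sided_ideal S mul I \<longleftrightarrow>
     I \<noteq> {} \<and> I \<subseteq> delta S mul \<and>
     (\<forall>p\<in>delta S mul. \<forall>q\<in>I. delta_mult S mul p q \<in> I \<and> delta_mult S mul q p \<in> I)"

text \<open>
  \<open>LEAST\<close> refers to inclusion. The least ideal exists when \<open>S\<close> is adequate, since then \<open>delta S mul\<close>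
  is a compact right topological semigroup.
\<close>

definition K_delta :: "'a set \<Rightarrow> ('a \<Rightarrow> 'a \<Rightarrow> 'a option) \<Rightarrow> 'a set set set" where
  "K_delta S mul = (LEAST I. two_sided_ideal S mul I)"

definition piecewise_syndetic :: "'a set \<Rightarrow> ('a \<Rightarrow> 'a \<Rightarrow> 'a option) \<Rightarrow> 'a set \<Rightarrow> bool" where
  "piecewise_syndetic S mul A \<longleftrightarrow> A \<subseteq> S \<and> beta_closure S A \<inter> K_delta S mul \<noteq> {}"

definition CR :: "'a set \<Rightarrow> ('a \<Rightarrow> 'a \<Rightarrow> 'a option) \<Rightarrow> 'a set set set" where
  "CR S mul = {p \<in> delta S mul. \<forall>A\<in>p. CR_set S mul A}"

end

theory Submission
  imports Defs
begin

text \<open>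
  \<open>CR(S)\<close> is either empty or a two-sided ideal of \<open>\<delta>S\<close>: a multiplication by \<open>y\<close> is absorbed into
  the first or last letter of the words \<open>a(1) * f(t(1)) * \<dots> * f(t(m)) * a(m+1)\<close>. As \<open>K(\<delta>S)\<close> is
  the least ideal, (1) implies (2); conversely, every point of \<open>K(\<delta>S) \<noteq> \<emptyset>\<close> witnesses (1) if (2) holds.
  Under (4), if there are adequate sequences, the complements of the non-CR sets form a proper filter.

  Closed subsets of \<open>\<beta>S\<close> are represented by families \<open>G\<close> of sets, through \<open>{p. G \<subseteq> p}\<close>. A maximal
  family defining a left ideal then yields a minimal left ideal, and \<open>K(\<delta>S)\<close> is the union of all of
  these.
\<close>

section \<open>Ultrafilters\<close>

text \<open>The finite intersection property. Intersecting with \<open>S\<close> handles the empty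
  subfamily, for which \<open>\<Inter>X\<close> is the whole type: it forces \<open>S\<close> itself
  to be nonempty.\<close>

definition fip :: "'a set \<Rightarrow> 'a set set \<Rightarrow> bool" where
  "fip S G \<longleftrightarrow> G \<subseteq> Pow S \<and> (\<forall>X. finite X \<and> X \<subseteq> G \<longrightarrow> S \<inter> \<Inter>X \<noteq> {})"

lemma finite_subset_Union_chain_member:
  assumes "C \<noteq> {}" "subset.chain \<A> C" "finite X" "X \<subseteq> \<Union>C"
  obtains G where "G \<in> C" "X \<subseteq> G"
  using finite_subset_Union_chain[OF assms(3,4,1), of \<A>] assms(2) by blast

text \<open>By maximality, a subset of \<open>S\<close> that meets all finite intersections of
  \<open>M\<close> already belongs to \<open>M\<close> (the fact \<open>ins\<close>). The closure
  properties of an ultrafilter are instances of this.\<close>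

lemma in_beta_if_maximal_fip:
  assumes M: "fip S M" and max: "\<And>N. fip S N \<Longrightarrow> M \<subseteq> N \<Longrightarrow> N = M"
  shows "M \<in> beta S"
proof -
  have ins: "A \<in> M" if "A \<subseteq> S" "\<And>X. finite X \<Longrightarrow> X \<subseteq> M \<Longrightarrow> S \<inter> A \<inter> \<Inter>X \<noteq> {}" for A
  proof -
    have "fip S (insert A M)"
      unfolding fip_def
    proof (intro conjI allI impI)
      show "insert A M \<subseteq> Pow S"
        using M that(1) by (auto simp: fip_def)
      fix X assume X: "finite X \<and> X \<subseteq> insert A M"
      then have "S \<inter> A \<inter> \<Inter>(X - {A}) \<noteq> {}"
        by (intro that(2)) auto
      then show "S \<inter> \<Inter>X \<noteq> {}"
        by blast
    qed
    then show ?thesis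
      using max[of "insert A M"] by blast
  qed
  have ne: "S \<inter> \<Inter>X \<noteq> {}" if "finite X" "X \<subseteq> M" for X
    using M that by (auto simp: fip_def)
  have sub: "A \<subseteq> S" if "A \<in> M" for A
    using M that by (auto simp: fip_def)
  have int: "A \<inter> B \<in> M" if "A \<in> M" "B \<in> M" for A B
  proof (rule ins)
    show "A \<inter> B \<subseteq> S" using sub that by blast
    fix X assume "finite X" "X \<subseteq> M"
    then show "S \<inter> (A \<inter> B) \<inter> \<Inter>X \<noteq> {}"
      using ne[of "insert A (insert B X)"] that by auto
  qed
  have up: "B \<in> M" if "A \<in> M" "A \<subseteq> B" "B \<subseteq> S" for A B
  proof (rule ins)
    fix X assume "finite X" "X \<subseteq> M"
    then show "S \<inter> B \<inter> \<Inter>X \<noteq> {}"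
      using ne[of "insert A X"] that by auto
  qed (use that in auto)
  have "{} \<notin> M"
    using ne[of "{{}}"] by auto
  moreover have "S \<in> M"
    by (rule ins) (use ne in auto)
  moreover have "A \<in> M \<or> S - A \<in> M" if A: "A \<subseteq> S" for A
  proof (rule ccontr)
    assume "\<not> ?thesis"
    \<comment> \<open>If neither set can be adjoined, one finite intersection misses
      \<open>A\<close> and another misses its complement, so their common refinement is
      empty.\<close>
    then obtain X Y where X: "finite X" "X \<subseteq> M" "S \<inter> A \<inter> \<Inter>X = {}"
      and Y: "finite Y" "Y \<subseteq> M" "S \<inter> (S - A) \<inter> \<Inter>Y = {}"
      using ins[OF A] ins[of "S - A"] by blast
    then have "S \<inter> \<Inter>(X \<union> Y) = {}"
      by blast
    then show False
      using ne[of "X \<union> Y"] X(1,2) Y(1,2) by simp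
  qed
  moreover have "M \<subseteq> Pow S"
    using sub by blast
  ultimately show ?thesis
    using int up unfolding beta_def mem_Collect_eq
    by (intro conjI ballI allI impI) (assumption | elim conjE | simp)+
qed

text \<open>Zorn's lemma on the families extending \<open>G\<close>: a finite subset of the union of
  a chain lies in a single member, so the finite intersection property passes to the union.\<close>

lemma ultrafilter_exists:
  assumes "fip S G"
  obtains p where "p \<in> beta S" "G \<subseteq> p"
proof -
  let ?\<A> = "{H. fip S H \<and> G \<subseteq> H}"
  have "\<exists>M\<in>?\<A>. \<forall>N\<in>?\<A>. M \<subseteq> N \<longrightarrow> N = M"
  proof (rule subset_Zorn_nonempty)
    show "?\<A> \<noteq> {}" using assms by blast
    fix C assume C: "C \<noteq> {}" "subset.chain ?\<A> C"
    then have sub: "C \<subseteq> ?\<A>"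
      by (auto simp: subset.chain_def)
    have "S \<inter> \<Inter>X \<noteq> {}" if X: "finite X" "X \<subseteq> \<Union>C" for X
    proof -
      obtain H where "H \<in> C" "X \<subseteq> H"
        by (rule finite_subset_Union_chain_member[OF C X])
      then show ?thesis using sub X(1) by (auto simp: fip_def)
    qed
    moreover have "\<Union>C \<subseteq> Pow S"
      using sub by (force simp: fip_def)
    moreover have "G \<subseteq> \<Union>C"
      using C(1) sub by blast
    ultimately show "\<Union>C \<in> ?\<A>"
      by (simp add: fip_def)
  qed
  then obtain M where "M \<in> ?\<A>" and "\<forall>N\<in>?\<A>. M \<subseteq> N \<longrightarrow> N = M"
    by (rule bexE)
  then have M: "fip S M" "G \<subseteq> M"
    and max: "\<And>N. fip S N \<Longrightarrow> G \<subseteq> N \<Longrightarrow> M \<subseteq> N \<Longrightarrow> N = M"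
    by simp_all
  have "M \<in> beta S"
    using M(1) by (rule in_beta_if_maximal_fip) (use max M(2) in blast)
  then show ?thesis
    using M(2) that by blast
qed

lemma fipI:
  assumes "G \<subseteq> Pow S" "G \<noteq> {}" "{} \<notin> G" "\<And>A B. A \<in> G \<Longrightarrow> B \<in> G \<Longrightarrow> A \<inter> B \<in> G"
  shows "fip S G"
  unfolding fip_def
proof (intro conjI allI impI)
  fix X assume X: "finite X \<and> X \<subseteq> G"
  from X have fin: "finite X" by blast
  from fin X have "X = {} \<or> \<Inter>X \<in> G"
    by (induction X rule: finite_induct) (use assms(4) in auto)
  then show "S \<inter> \<Inter>X \<noteq> {}"
  proof
    assume "X = {}"
    then show ?thesis using assms(1-3) by auto
  next
    assume "\<Inter>X \<in> G"
    then have "\<Inter>X \<subseteq> S" "\<Inter>X \<noteq> {}" using assms(1,3) by (blast, metis)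
    then show ?thesis by blast
  qed
qed (fact assms(1))

lemma beta_Int: "p \<in> beta S \<Longrightarrow> A \<in> p \<Longrightarrow> B \<in> p \<Longrightarrow> A \<inter> B \<in> p"
  by (auto simp: beta_def)

lemma beta_mono: "p \<in> beta S \<Longrightarrow> A \<in> p \<Longrightarrow> A \<subseteq> B \<Longrightarrow> B \<subseteq> S \<Longrightarrow> B \<in> p"
  by (auto simp: beta_def)

lemma beta_subset: "p \<in> beta S \<Longrightarrow> A \<in> p \<Longrightarrow> A \<subseteq> S"
  by (auto simp: beta_def)

lemma beta_UNIV: "p \<in> beta S \<Longrightarrow> S \<in> p"
  by (auto simp: beta_def)

lemma beta_not_empty: "p \<in> beta S \<Longrightarrow> {} \<notin> p"
  by (auto simp: beta_def)

lemma beta_Compl_iff: "p \<in> beta S \<Longrightarrow> A \<subseteq> S \<Longrightarrow> S - A \<in> p \<longleftrightarrow> A \<notin> p"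
  unfolding beta_def using Diff_disjoint[of A S] by (smt (verit) mem_Collect_eq)

lemma beta_Inter:
  assumes "p \<in> beta S" "finite X" "X \<subseteq> p"
  shows "S \<inter> \<Inter>X \<in> p"
  using assms(2,3)
proof (induction X rule: finite_induct)
  case (insert A X)
  then have "A \<inter> (S \<inter> \<Inter>X) \<in> p"
    using beta_Int[OF assms(1)] by auto
  then show ?case by (simp add: Int_left_commute)
qed (use beta_UNIV[OF assms(1)] in simp)

text \<open>Ultrafilters are maximal: a set in \<open>q\<close> but not in \<open>p\<close> would
  have its complement in \<open>p\<close>, hence in \<open>q\<close>.\<close>

lemma beta_eqI:
  assumes "p \<in> beta S" "q \<in> beta S" "p \<subseteq> q"
  shows "p = q"
  using assms beta_Compl_iff beta_subset by blast

lemma fip_if_subset_beta: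
  assumes "p \<in> beta S" "G \<subseteq> p"
  shows "fip S G"
  unfolding fip_def
proof (intro conjI allI impI)
  show "G \<subseteq> Pow S"
    using assms beta_subset by blast
  fix X assume "finite X \<and> X \<subseteq> G"
  then have "S \<inter> \<Inter>X \<in> p"
    using assms(2) by (intro beta_Inter[OF assms(1)]) auto
  then show "S \<inter> \<Inter>X \<noteq> {}"
    using beta_not_empty[OF assms(1)] by metis
qed

section \<open>Products of words\<close>

locale adequate_psg =
  fixes S :: "'a set" and mul :: "'a \<Rightarrow> 'a \<Rightarrow> 'a option"
  assumes adequate: "adequate_partial_semigroup S mul"
begin

lemma mul_closed:
  assumes "mul x y = Some z"
  shows "x \<in> S" "y \<in> S" "z \<in> S"
  using adequate assms by (auto simp: adequate_partial_semigroup_def partial_semigroup_def)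

text \<open>Products with a factor outside \<open>S\<close> are undefined, so associativity extends
  from \<open>S\<close> to the whole type and needs no membership side conditions later.\<close>

lemma mul_assoc:
  "Option.bind (mul x y) (\<lambda>u. mul u z) = Option.bind (mul y z) (mul x)"
proof (cases "x \<in> S \<and> y \<in> S \<and> z \<in> S")
  case True
  then show ?thesis
    using adequate unfolding adequate_partial_semigroup_def partial_semigroup_def by blast
next
  case False
  then have "Option.bind (mul x y) (\<lambda>u. mul u z) = None" "Option.bind (mul y z) (mul x) = None"
    using mul_closed by (auto simp: bind_eq_None_conv) (metis not_Some_eq)+
  then show ?thesis by simp
qed

lemma mul_assoc_right:
  assumes "mul x y = Some u" "mul u z = Some w"
  obtains v where "mul y z = Some v" "mul x v = Some w"
proof -
  have "Option.bind (mul y z) (mul x) = Some w"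
    using mul_assoc[of x y z] assms by simp
  then show ?thesis
    using that by (auto simp: bind_eq_Some_conv)
qed

lemma mul_assoc_left:
  assumes "mul y z = Some v" "mul x v = Some w"
  obtains u where "mul x y = Some u" "mul u z = Some w"
proof -
  have "Option.bind (mul x y) (\<lambda>u. mul u z) = Some w"
    using mul_assoc[of x y z] assms by simp
  then show ?thesis
    using that by (auto simp: bind_eq_Some_conv)
qed

lemma word_prod_Cons: "ws \<noteq> [] \<Longrightarrow> word_prod mul (x # ws) = Option.bind (word_prod mul ws) (mul x)"
  by (cases ws) auto

text \<open>Associativity moves \<open>y\<close> inwards past each letter, and definedness moves
  with it. The new last letter \<open>zy\<close> depends on \<open>z\<close> and \<open>y\<close>
  alone, so it is the same for all words ending in \<open>z\<close>.\<close>

lemma word_prod_mul_right: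
  assumes "word_prod mul (ws @ [z]) = Some w" "mul w y = Some v"
  shows "\<exists>zy. mul z y = Some zy \<and> word_prod mul (ws @ [zy]) = Some v"
  using assms
proof (induction ws arbitrary: w v)
  case (Cons x ws)
  then obtain w' where w': "word_prod mul (ws @ [z]) = Some w'" "mul x w' = Some w"
    by (auto simp: word_prod_Cons bind_eq_Some_conv)
  obtain v' where "mul w' y = Some v'" "mul x v' = Some v"
    using mul_assoc_right[OF w'(2) Cons.prems(2)] .
  then show ?case
    using Cons.IH[OF w'(1)] by (auto simp: word_prod_Cons)
qed auto

lemma word_prod_mul_left:
  assumes "word_prod mul (z # ws) = Some w" "mul y w = Some v"
  shows "\<exists>yz. mul y z = Some yz \<and> word_prod mul (yz # ws) = Some v"
proof (cases "ws = []")
  case False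
  then obtain w' where "word_prod mul ws = Some w'" "mul z w' = Some w"
    using assms by (auto simp: word_prod_Cons bind_eq_Some_conv)
  then show ?thesis
    using False assms(2) by (auto simp: word_prod_Cons elim: mul_assoc_left)
qed (use assms in auto)

lemma sigma_iff: "F \<in> \<P>\<^sub>f S \<Longrightarrow> b \<in> sigma S mul F \<longleftrightarrow> (\<forall>a\<in>F. mul a b \<noteq> None)"
  using mul_closed by (fastforce simp: sigma_def phi_def finite_nonempty_subsets_def)

lemma sigma_subset: "F \<in> \<P>\<^sub>f S \<Longrightarrow> sigma S mul F \<subseteq> S"
  by (auto simp: sigma_def phi_def finite_nonempty_subsets_def)

lemma sigma_nonempty: "F \<in> \<P>\<^sub>f S \<Longrightarrow> sigma S mul F \<noteq> {}"
  using adequate by (auto simp: adequate_partial_semigroup_def)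

section \<open>The semigroup of ultrafilters\<close>

abbreviation \<delta> where "\<delta> \<equiv> delta S mul"

abbreviation conv (infixl \<open>\<star>\<close> 70) where "p \<star> q \<equiv> delta_mult S mul p q"

abbreviation quot where "quot \<equiv> left_quotient S mul"

lemma quot_iff: "y \<in> quot x A \<longleftrightarrow> (\<exists>z\<in>A. mul x y = Some z)"
  using mul_closed by (auto simp: left_quotient_def phi_def)

lemma P\<^sub>f_nonempty: "\<P>\<^sub>f S \<noteq> {}"
proof -
  obtain x where "x \<in> S"
    using adequate by (auto simp: adequate_partial_semigroup_def partial_semigroup_def)
  then have "{x} \<in> \<P>\<^sub>f S"
    by (auto simp: finite_nonempty_subsets_def)
  then show ?thesis by blast
qed

lemma in_delta_iff: "p \<in> \<delta> \<longleftrightarrow> p \<in> beta S \<and> (\<forall>F\<in>\<P>\<^sub>f S. sigma S mul F \<in> p)"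
  using P\<^sub>f_nonempty by (auto simp: delta_def beta_closure_def)

lemma delta_beta: "p \<in> \<delta> \<Longrightarrow> p \<in> beta S"
  by (simp add: in_delta_iff)

lemma delta_sigma: "p \<in> \<delta> \<Longrightarrow> F \<in> \<P>\<^sub>f S \<Longrightarrow> sigma S mul F \<in> p"
  by (simp add: in_delta_iff)

lemma quot_subset: "quot x A \<subseteq> S"
  by (auto simp: left_quotient_def phi_def)

lemma quot_S_in_delta: "q \<in> \<delta> \<Longrightarrow> x \<in> S \<Longrightarrow> quot x S \<in> q"
  using delta_sigma[of q "{x}"] mul_closed
  by (auto simp: finite_nonempty_subsets_def left_quotient_def phi_def sigma_def
      elim!: back_subst[of "\<lambda>A. A \<in> q"])

text \<open>The operation on sets dual to right translation by \<open>q\<close>: \<open>A\<close>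
  belongs to \<open>p \<star> q\<close> iff its pullback belongs to \<open>p\<close>. For
  \<open>q\<close> in \<open>\<delta>\<close> it is a homomorphism of the Boolean algebra of subsets
  of \<open>S\<close>, as the next lemmas show.\<close>

definition pull :: "'a set set \<Rightarrow> 'a set \<Rightarrow> 'a set" where
  "pull q A = {x \<in> S. quot x A \<in> q}"

lemma in_conv_iff: "A \<in> p \<star> q \<longleftrightarrow> A \<subseteq> S \<and> pull q A \<in> p"
  by (simp add: delta_mult_def pull_def)

lemma pull_subset: "pull q A \<subseteq> S"
  by (auto simp: pull_def)

lemma pull_S: "q \<in> \<delta> \<Longrightarrow> pull q S = S"
  using quot_S_in_delta by (auto simp: pull_def)

lemma pull_empty: "q \<in> \<delta> \<Longrightarrow> pull q {} = {}"
  using beta_not_empty[OF delta_beta] by (auto simp: pull_def left_quotient_def)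

lemma pull_mono: "q \<in> \<delta> \<Longrightarrow> A \<subseteq> B \<Longrightarrow> pull q A \<subseteq> pull q B"
  unfolding pull_def
  using beta_mono[OF delta_beta, of q _ _] quot_subset quot_iff
  by (smt (verit, best) Collect_mono subset_iff)

lemma pull_Int: "q \<in> \<delta> \<Longrightarrow> pull q (A \<inter> B) = pull q A \<inter> pull q B"
proof
  assume q: "q \<in> \<delta>"
  then show "pull q (A \<inter> B) \<subseteq> pull q A \<inter> pull q B"
    by (simp add: pull_mono)
  have "quot x A \<inter> quot x B = quot x (A \<inter> B)" for x
    by (auto simp: left_quotient_def)
  then show "pull q A \<inter> pull q B \<subseteq> pull q (A \<inter> B)"
    using beta_Int[OF delta_beta[OF q]] by (fastforce simp: pull_def)
qed

text \<open>The sets \<open>quot x (S - A)\<close> and \<open>S - quot x A\<close> differ only where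
  \<open>x * y\<close> is undefined, and the domain \<open>quot x S\<close> is a member of
  \<open>q\<close>.\<close>

lemma pull_Compl:
  assumes "q \<in> \<delta>"
  shows "pull q (S - A) = S - pull q A"
proof -
  have "quot x (S - A) \<in> q \<longleftrightarrow> quot x A \<notin> q" if "x \<in> S" for x
  proof -
    have *: "quot x S \<inter> (S - quot x A) = quot x (S - A)" "quot x (S - A) \<subseteq> S - quot x A"
      by (auto simp: left_quotient_def phi_def)
    have "quot x (S - A) \<in> q \<longleftrightarrow> S - quot x A \<in> q"
      using beta_Int[OF delta_beta[OF assms] quot_S_in_delta[OF assms that], of "S - quot x A"]
        beta_mono[OF delta_beta[OF assms], of "quot x (S - A)" "S - quot x A"] *
      by auto
    then show ?thesis
      using beta_Compl_iff[OF delta_beta[OF assms] quot_subset] by simp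
  qed
  then show ?thesis by (auto simp: pull_def)
qed

lemma translate_in_Pf:
  assumes "F \<in> \<P>\<^sub>f S" "x \<in> sigma S mul F"
  shows "(\<lambda>a. the (mul a x)) ` F \<in> \<P>\<^sub>f S"
proof -
  have "the (mul a x) \<in> S" if "a \<in> F" for a
    using assms that sigma_iff[of F x] mul_closed(3)[of a x] by auto
  then show ?thesis
    using assms by (auto simp: finite_nonempty_subsets_def)
qed

text \<open>This is \<open>(a * x) * y = a * (x * y)\<close>: requiring \<open>y\<close> to be
  multipliable by the translates \<open>a * x\<close> makes \<open>a * (x * y)\<close> defined. It
  is the means of keeping products inside \<open>sigma\<close>.\<close>

lemma mul_sigma:
  assumes "F \<in> \<P>\<^sub>f S" "x \<in> sigma S mul F" "y \<in> sigma S mul ((\<lambda>a. the (mul a x)) ` F)"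
    and "mul x y = Some z"
  shows "z \<in> sigma S mul F"
proof -
  have "mul a z \<noteq> None" if a: "a \<in> F" for a
  proof -
    obtain u where u: "mul a x = Some u"
      using assms(1,2) a by (auto simp: sigma_iff)
    have "u \<in> (\<lambda>a. the (mul a x)) ` F"
      using u a by force
    then obtain w where "mul u y = Some w"
      using assms(3) by (auto simp: sigma_def phi_def)
    then show ?thesis
      using assms(4) mul_assoc_right[OF u, of y w] by auto
  qed
  then show ?thesis using assms(1) by (simp add: sigma_iff)
qed

lemma conv_delta:
  assumes p: "p \<in> \<delta>" and q: "q \<in> \<delta>"
  shows "p \<star> q \<in> \<delta>"
  unfolding in_delta_iff
proof (intro conjI ballI)
  note pb = delta_beta[OF p]
  show "p \<star> q \<in> beta S"
    unfolding beta_def mem_Collect_eq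
  proof (intro conjI ballI allI impI)
    show "p \<star> q \<subseteq> Pow S" by (auto simp: in_conv_iff)
    show "S \<in> p \<star> q" using pull_S[OF q] beta_UNIV[OF pb] by (simp add: in_conv_iff)
    show "{} \<notin> p \<star> q" using pull_empty[OF q] beta_not_empty[OF pb] by (simp add: in_conv_iff)
    show "A \<inter> B \<in> p \<star> q" if "A \<in> p \<star> q" "B \<in> p \<star> q" for A B
      using that pull_Int[OF q] beta_Int[OF pb] by (auto simp: in_conv_iff)
    show "B \<in> p \<star> q" if "A \<in> p \<star> q" "A \<subseteq> B \<and> B \<subseteq> S" for A B
      using that beta_mono[OF pb _ pull_mono[OF q] pull_subset] by (auto simp: in_conv_iff)
    show "A \<in> p \<star> q \<or> S - A \<in> p \<star> q" if "A \<subseteq> S" for A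
      using that pull_Compl[OF q] beta_Compl_iff[OF pb pull_subset] by (auto simp: in_conv_iff)
  qed
  fix F assume F: "F \<in> \<P>\<^sub>f S"
  \<comment> \<open>For \<open>x\<close> in \<open>sigma S mul F\<close>, the elements
    \<open>y\<close> that lie in \<open>sigma\<close> of the translate of \<open>F\<close> by
    \<open>x\<close> and have \<open>x * y\<close> defined form a member of
    \<open>q\<close>.\<close>
  have "sigma S mul F \<subseteq> pull q (sigma S mul F)"
  proof
    fix x assume x: "x \<in> sigma S mul F"
    then have xS: "x \<in> S" using sigma_subset[OF F] by blast
    have "quot x S \<inter> sigma S mul ((\<lambda>a. the (mul a x)) ` F) \<in> q"
      using beta_Int[OF delta_beta[OF q] quot_S_in_delta[OF q xS]
          delta_sigma[OF q translate_in_Pf[OF F x]]] .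
    moreover have "quot x S \<inter> sigma S mul ((\<lambda>a. the (mul a x)) ` F) \<subseteq> quot x (sigma S mul F)"
      using mul_sigma[OF F x] by (auto simp: quot_iff)
    ultimately show "x \<in> pull q (sigma S mul F)"
      using beta_mono[OF delta_beta[OF q] _ _ quot_subset] xS by (auto simp: pull_def)
  qed
  then show "sigma S mul F \<in> p \<star> q"
    using beta_mono[OF pb delta_sigma[OF p F] _ pull_subset] sigma_subset[OF F]
    by (simp add: in_conv_iff)
qed

text \<open>Everything reduces to \<open>pull q (pull r A) = pull (q \<star> r) A\<close>, that is,
  to interchanging \<open>quot x\<close> and \<open>pull r\<close>.\<close>

lemma conv_assoc:
  assumes r: "r \<in> \<delta>"
  shows "(p \<star> q) \<star> r = p \<star> (q \<star> r)"
proof -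
  have "quot x (pull r A) = pull r (quot x A)" for x A
  proof -
    have eq: "quot y (quot x A) = (case mul x y of None \<Rightarrow> {} | Some u \<Rightarrow> quot u A)" for y
    proof (rule set_eqI)
      fix z
      have "z \<in> quot y (quot x A) \<longleftrightarrow> (\<exists>w\<in>A. Option.bind (mul y z) (mul x) = Some w)"
        by (auto simp: quot_iff bind_eq_Some_conv)
      also have "\<dots> \<longleftrightarrow> (\<exists>w\<in>A. Option.bind (mul x y) (\<lambda>u. mul u z) = Some w)"
        by (simp only: mul_assoc)
      also have "\<dots> \<longleftrightarrow> z \<in> (case mul x y of None \<Rightarrow> {} | Some u \<Rightarrow> quot u A)"
        by (auto simp: quot_iff split: option.split)
      finally show "z \<in> quot y (quot x A) \<longleftrightarrow> z \<in> (case mul x y of None \<Rightarrow> {} | Some u \<Rightarrow> quot u A)" .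
    qed
    \<comment> \<open>If \<open>x * y\<close> is undefined, the iterated quotient is empty. As
      \<open>r\<close> omits the empty set, such \<open>y\<close> are excluded on both
      sides.\<close>
    have "{} \<notin> r" using beta_not_empty[OF delta_beta[OF r]] .
    then have "y \<in> pull r (quot x A) \<longleftrightarrow> (\<exists>u. mul x y = Some u \<and> quot u A \<in> r)" for y
      using mul_closed(2)[of x y] by (auto simp: pull_def eq split: option.splits)
    moreover have "y \<in> quot x (pull r A) \<longleftrightarrow> (\<exists>u. mul x y = Some u \<and> quot u A \<in> r)" for y
      using mul_closed(3)[of x y] by (auto simp: pull_def quot_iff)
    ultimately show ?thesis by blast
  qed
  then have "pull q (pull r A) = pull (q \<star> r) A" for A
    by (simp add: pull_def[of q] pull_def[of "q \<star> r"] in_conv_iff quot_subset)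
  then show ?thesis
    by (auto simp: in_conv_iff pull_subset)
qed

section \<open>Closed subsets and compactness of \<open>\<delta>\<close>\<close>

definition Cl :: "'a set set \<Rightarrow> 'a set set set" where
  "Cl G = {p \<in> \<delta>. G \<subseteq> p}"

text \<open>Since \<open>sigma\<close> turns unions into intersections, adequacy makes these sets a
  filter base. The ultrafilters containing it are exactly the points of
  \<open>\<delta>\<close>.\<close>

lemma fip_sigma: "fip S (sigma S mul ` \<P>\<^sub>f S)"
proof (rule fipI)
  show "sigma S mul ` \<P>\<^sub>f S \<subseteq> Pow S"
    using sigma_subset by blast
  show "sigma S mul ` \<P>\<^sub>f S \<noteq> {}"
    using P\<^sub>f_nonempty by blast
  show "{} \<notin> sigma S mul ` \<P>\<^sub>f S"
    using sigma_nonempty by (metis imageE)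
  show "A \<inter> B \<in> sigma S mul ` \<P>\<^sub>f S"
    if AB: "A \<in> sigma S mul ` \<P>\<^sub>f S" "B \<in> sigma S mul ` \<P>\<^sub>f S" for A B
  proof -
    obtain F G where FG: "F \<in> \<P>\<^sub>f S" "G \<in> \<P>\<^sub>f S" "A = sigma S mul F" "B = sigma S mul G"
      using AB by blast
    then have "A \<inter> B = sigma S mul (F \<union> G)" "F \<union> G \<in> \<P>\<^sub>f S"
      by (auto simp: sigma_def finite_nonempty_subsets_def)
    then show ?thesis by blast
  qed
qed

lemma delta_nonempty: "\<delta> \<noteq> {}"
  using ultrafilter_exists[OF fip_sigma] by (metis empty_iff image_subset_iff in_delta_iff)

text \<open>The image of a compact space under a continuous map is closed. The family chosen for
  \<open>G\<close> consists of the sets forced into every \<open>p \<star> q\<close> because their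
  pullbacks contain some \<open>sigma S mul F\<close>.\<close>

lemma delta_conv_closed:
  assumes q: "q \<in> \<delta>"
  obtains G where "Cl G = (\<lambda>p. p \<star> q) ` \<delta>"
proof
  let ?G = "{A. A \<subseteq> S \<and> (\<exists>F\<in>\<P>\<^sub>f S. sigma S mul F \<subseteq> pull q A)}"
  show "Cl ?G = (\<lambda>p. p \<star> q) ` \<delta>"
  proof
    show "(\<lambda>p. p \<star> q) ` \<delta> \<subseteq> Cl ?G"
    proof
      fix u assume "u \<in> (\<lambda>p. p \<star> q) ` \<delta>"
      then obtain p where p: "p \<in> \<delta>" "u = p \<star> q" by blast
      have "?G \<subseteq> u"
        using beta_mono[OF delta_beta[OF p(1)] delta_sigma[OF p(1)] _ pull_subset]
        by (auto simp: p(2) in_conv_iff)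
      then show "u \<in> Cl ?G"
        using conv_delta[OF p(1) q] p(2) by (simp add: Cl_def)
    qed
    show "Cl ?G \<subseteq> (\<lambda>p. p \<star> q) ` \<delta>"
    proof
      fix u assume "u \<in> Cl ?G"
      then have u: "u \<in> \<delta>" "?G \<subseteq> u" by (auto simp: Cl_def)
      note ub = delta_beta[OF u(1)]
      \<comment> \<open>An ultrafilter \<open>p\<close> containing \<open>?H\<close> lies in
        \<open>\<delta>\<close> and contains the pullbacks of all members of \<open>u\<close>, so
        \<open>u \<subseteq> p \<star> q\<close> and equality follows. Were an element of
        \<open>?H\<close> empty, the complement of some \<open>A\<close> in \<open>u\<close> would
        lie in \<open>?G\<close>, hence in \<open>u\<close>.\<close>
      let ?H = "{sigma S mul F \<inter> pull q A |F A. F \<in> \<P>\<^sub>f S \<and> A \<in> u}"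
      have "fip S ?H"
      proof (rule fipI)
        show "?H \<subseteq> Pow S" using pull_subset by blast
        show "?H \<noteq> {}" using beta_UNIV[OF ub] P\<^sub>f_nonempty by blast
        show "{} \<notin> ?H"
        proof
          assume "{} \<in> ?H"
          then obtain F A where FA: "F \<in> \<P>\<^sub>f S" "A \<in> u" "sigma S mul F \<inter> pull q A = {}"
            by blast
          then have "sigma S mul F \<subseteq> pull q (S - A)"
            using pull_Compl[OF q] sigma_subset by blast
          then have "S - A \<in> u" using FA(1) u(2) by blast
          then show False
            using FA(2) beta_Compl_iff[OF ub] beta_subset[OF ub] by blast
        qed
        show "B \<inter> C \<in> ?H" if BC: "B \<in> ?H" "C \<in> ?H" for B C
        proof -
          obtain F A F' A' where *: "F \<in> \<P>\<^sub>f S" "A \<in> u" "B = sigma S mul F \<inter> pull q A"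
            "F' \<in> \<P>\<^sub>f S" "A' \<in> u" "C = sigma S mul F' \<inter> pull q A'"
            using BC by blast
          have "B \<inter> C = sigma S mul (F \<union> F') \<inter> pull q (A \<inter> A')"
            using pull_Int[OF q] * by (auto simp: sigma_def)
          moreover have "F \<union> F' \<in> \<P>\<^sub>f S"
            using * by (auto simp: finite_nonempty_subsets_def)
          ultimately show ?thesis
            using beta_Int[OF ub *(2,5)] by blast
        qed
      qed
      then obtain p where p: "p \<in> beta S" "?H \<subseteq> p" by (rule ultrafilter_exists)
      have "sigma S mul F \<in> p" if "F \<in> \<P>\<^sub>f S" for F
        using p(2) pull_S[OF q] beta_UNIV[OF ub] sigma_subset[OF that] that
          beta_mono[OF p(1) _ Int_lower1[of _ "pull q S"]] by blast
      then have pd: "p \<in> \<delta>" using p(1) by (simp add: in_delta_iff)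
      have "pull q A \<in> p" if "A \<in> u" for A
        using p(2) P\<^sub>f_nonempty that beta_mono[OF p(1) _ Int_lower2 pull_subset] by blast
      then have "u \<subseteq> p \<star> q"
        using beta_subset[OF ub] by (auto simp: in_conv_iff)
      then have "u = p \<star> q"
        using beta_eqI[OF ub delta_beta[OF conv_delta[OF pd q]]] by blast
      then show "u \<in> (\<lambda>p. p \<star> q) ` \<delta>" using pd by blast
    qed
  qed
qed

section \<open>The least ideal\<close>

definition left_ideal :: "'a set set set \<Rightarrow> bool" where
  "left_ideal J \<longleftrightarrow> J \<noteq> {} \<and> J \<subseteq> \<delta> \<and> (\<forall>p\<in>\<delta>. \<forall>q\<in>J. p \<star> q \<in> J)"

definition minimal_left_ideal :: "'a set set set \<Rightarrow> bool" where
  "minimal_left_ideal J \<longleftrightarrow> left_ideal J \<and> (\<forall>I. left_ideal I \<and> I \<subseteq> J \<longrightarrow> I = J)"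

lemma left_ideal_delta_conv:
  assumes "q \<in> \<delta>"
  shows "left_ideal ((\<lambda>p. p \<star> q) ` \<delta>)"
  unfolding left_ideal_def
  using delta_nonempty conv_delta assms
  by (auto simp: conv_assoc[OF assms, symmetric])

text \<open>Compactness: finitely many requirements from the chain come from one member, and a point
  of its closed set meets them. The \<open>sigma\<close> sets are adjoined so that the resulting
  ultrafilter lies in \<open>\<delta>\<close>.\<close>

lemma Cl_Union_chain_nonempty:
  assumes "C \<noteq> {}" "subset.chain \<A> C" "\<And>G. G \<in> C \<Longrightarrow> Cl G \<noteq> {}"
  shows "Cl (\<Union>C) \<noteq> {}"
proof -
  have "fip S (sigma S mul ` \<P>\<^sub>f S \<union> \<Union>C)"
    unfolding fip_def
  proof (intro conjI allI impI)
    have "G \<subseteq> Pow S" if "G \<in> C" for G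
      using assms(3)[OF that] by (auto simp: Cl_def in_delta_iff dest: beta_subset)
    then show "sigma S mul ` \<P>\<^sub>f S \<union> \<Union>C \<subseteq> Pow S"
      using sigma_subset by blast
    fix X assume X: "finite X \<and> X \<subseteq> sigma S mul ` \<P>\<^sub>f S \<union> \<Union>C"
    obtain G where G: "G \<in> C" "X - sigma S mul ` \<P>\<^sub>f S \<subseteq> G"
      by (rule finite_subset_Union_chain_member[OF assms(1,2), of "X - sigma S mul ` \<P>\<^sub>f S"])
        (use X in auto)
    then obtain p where p: "p \<in> \<delta>" "G \<subseteq> p"
      using assms(3)[OF G(1)] by (auto simp: Cl_def)
    then have "X \<subseteq> p"
      using G(2) delta_sigma by blast
    then show "S \<inter> \<Inter>X \<noteq> {}"
      using fip_if_subset_beta[OF delta_beta[OF p(1)]] X by (simp add: fip_def)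
  qed
  then obtain p where p: "p \<in> beta S" "sigma S mul ` \<P>\<^sub>f S \<union> \<Union>C \<subseteq> p"
    by (rule ultrafilter_exists)
  then have "p \<in> Cl (\<Union>C)"
    by (auto simp: Cl_def in_delta_iff)
  then show ?thesis by blast
qed

text \<open>As \<open>Cl\<close> reverses inclusion, a maximal family gives a minimal closed left
  ideal. It is minimal among all left ideals, since each left ideal contains a closed one, the set
  of all \<open>p \<star> q\<close> for any of its points \<open>q\<close>.\<close>

lemma minimal_left_ideal_exists: "\<exists>J. minimal_left_ideal J"
proof -
  let ?\<A> = "{G. left_ideal (Cl G)}"
  have "\<exists>M\<in>?\<A>. \<forall>N\<in>?\<A>. M \<subseteq> N \<longrightarrow> N = M"
  proof (rule subset_Zorn_nonempty)
    have "Cl {} = \<delta>" by (auto simp: Cl_def)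
    then have "left_ideal (Cl {})"
      using delta_nonempty conv_delta by (auto simp: left_ideal_def)
    then show "?\<A> \<noteq> {}" by blast
    fix C assume C: "C \<noteq> {}" "subset.chain ?\<A> C"
    then have sub: "left_ideal (Cl G)" if "G \<in> C" for G
      using that by (auto simp: subset.chain_def)
    have "Cl (\<Union>C) \<noteq> {}"
      by (rule Cl_Union_chain_nonempty[OF C]) (use sub in \<open>auto simp: left_ideal_def\<close>)
    moreover have "Cl (\<Union>C) = (\<Inter>G\<in>C. Cl G)"
      using C(1) by (auto simp: Cl_def)
    moreover have "(\<Inter>G\<in>C. Cl G) \<subseteq> \<delta>"
      using C(1) by (auto simp: Cl_def)
    moreover have "p \<star> q \<in> (\<Inter>G\<in>C. Cl G)" if "p \<in> \<delta>" "q \<in> (\<Inter>G\<in>C. Cl G)" for p q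
      using sub that unfolding left_ideal_def by blast
    ultimately show "\<Union>C \<in> ?\<A>"
      by (simp add: left_ideal_def)
  qed
  then obtain M where M: "left_ideal (Cl M)"
    and max: "\<And>N. left_ideal (Cl N) \<Longrightarrow> M \<subseteq> N \<Longrightarrow> N = M"
    by blast
  have "I = Cl M" if I: "left_ideal I" "I \<subseteq> Cl M" for I
  proof -
    obtain q where q: "q \<in> I" "q \<in> \<delta>"
      using I by (auto simp: left_ideal_def)
    obtain G where G: "Cl G = (\<lambda>p. p \<star> q) ` \<delta>"
      by (rule delta_conv_closed[OF q(2)])
    have GI: "Cl G \<subseteq> I"
      using I(1) q(1) by (auto simp: G left_ideal_def)
    \<comment> \<open>Adjoining \<open>M\<close> represents the same closed left ideal by a family
      extending \<open>M\<close>, to which maximality applies.\<close>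
    have "Cl (M \<union> G) = Cl M \<inter> Cl G"
      by (auto simp: Cl_def)
    also have "\<dots> = Cl G"
      using GI I(2) by blast
    finally have "left_ideal (Cl (M \<union> G))"
      using left_ideal_delta_conv[OF q(2)] by (simp add: G)
    then have "M \<union> G = M"
      using max by blast
    then have "Cl M \<subseteq> Cl G"
      by (auto simp: Cl_def)
    then show ?thesis using GI I(2) by blast
  qed
  then show ?thesis
    using M unfolding minimal_left_ideal_def by blast
qed

text \<open>For a left ideal \<open>I\<close> inside the translate, the points of \<open>J\<close>
  sent into \<open>I\<close> form a left ideal, which is all of \<open>J\<close> by
  minimality.\<close>

lemma minimal_left_ideal_conv:
  assumes J: "minimal_left_ideal J" and q: "q \<in> \<delta>"
  shows "minimal_left_ideal ((\<lambda>p. p \<star> q) ` J)"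
  unfolding minimal_left_ideal_def
proof (intro conjI allI impI)
  have lJ: "left_ideal J" using J by (simp add: minimal_left_ideal_def)
  then show "left_ideal ((\<lambda>p. p \<star> q) ` J)"
    using conv_delta q conv_assoc[OF q, symmetric] by (auto simp: left_ideal_def)
  fix I assume I: "left_ideal I \<and> I \<subseteq> (\<lambda>p. p \<star> q) ` J"
  have "left_ideal {x \<in> J. x \<star> q \<in> I}"
    unfolding left_ideal_def
  proof (intro conjI)
    show "{x \<in> J. x \<star> q \<in> I} \<noteq> {}"
      using I by (auto simp: left_ideal_def)
    show "{x \<in> J. x \<star> q \<in> I} \<subseteq> \<delta>"
      using lJ by (auto simp: left_ideal_def)
    show "\<forall>p\<in>\<delta>. \<forall>x\<in>{x \<in> J. x \<star> q \<in> I}. p \<star> x \<in> {x \<in> J. x \<star> q \<in> I}"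
      using lJ I by (auto simp: left_ideal_def conv_assoc[OF q])
  qed
  then have "{x \<in> J. x \<star> q \<in> I} = J"
    using J unfolding minimal_left_ideal_def by blast
  then show "I = (\<lambda>p. p \<star> q) ` J" using I by blast
qed

text \<open>Right translation permutes the union of the minimal left ideals into itself, so the
  union is two-sided. Any two-sided ideal \<open>I\<close> meets each minimal left ideal in a left
  ideal, hence contains it.\<close>

lemma two_sided_ideal_K: "two_sided_ideal S mul (K_delta S mul)"
  and K_delta_least: "two_sided_ideal S mul I \<Longrightarrow> K_delta S mul \<subseteq> I"
proof -
  let ?K = "\<Union>{J. minimal_left_ideal J}"
  have 1: "two_sided_ideal S mul ?K"
    unfolding two_sided_ideal_def
  proof (intro conjI ballI)
    show "?K \<noteq> {}"
      using minimal_left_ideal_exists by (auto simp: minimal_left_ideal_def left_ideal_def)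
    show "?K \<subseteq> \<delta>"
      by (auto simp: minimal_left_ideal_def left_ideal_def)
    fix p q assume p: "p \<in> \<delta>" and "q \<in> ?K"
    then obtain J where J: "minimal_left_ideal J" "q \<in> J" by blast
    then have "p \<star> q \<in> J"
      using p by (simp add: minimal_left_ideal_def left_ideal_def)
    then show "p \<star> q \<in> ?K"
      using J(1) by blast
    show "q \<star> p \<in> ?K"
      using minimal_left_ideal_conv[OF J(1) p] J(2) by blast
  qed
  have 2: "?K \<subseteq> I" if I: "two_sided_ideal S mul I" for I
  proof
    fix x assume "x \<in> ?K"
    then obtain J where J: "minimal_left_ideal J" "x \<in> J" by blast
    then have lJ: "left_ideal J" by (simp add: minimal_left_ideal_def)
    obtain i where i: "i \<in> I" "i \<in> \<delta>" using I by (auto simp: two_sided_ideal_def)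
    have "i \<star> x \<in> I \<inter> J"
      using I lJ i J(2) by (auto simp: two_sided_ideal_def left_ideal_def)
    then have "left_ideal (I \<inter> J)"
      using I lJ unfolding two_sided_ideal_def left_ideal_def by blast
    then have "I \<inter> J = J" using J(1) unfolding minimal_left_ideal_def by blast
    then show "x \<in> I" using J(2) by blast
  qed
  have "K_delta S mul = ?K"
    unfolding K_delta_def by (rule Least_equality) (use 1 2 in auto)
  then show "two_sided_ideal S mul (K_delta S mul)"
    and "two_sided_ideal S mul I \<Longrightarrow> K_delta S mul \<subseteq> I"
    using 1 2 by auto
qed

section \<open>CR sets\<close>

abbreviation \<T> where "\<T> \<equiv> adequate_seqs S mul"

text \<open>Isolates the dependence on the coefficients \<open>a\<close>, the only part of a witness
  that changes below; \<open>m\<close>, \<open>t\<close>, \<open>F\<close> and the bound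
  \<open>r\<close> are retained.\<close>

definition realizes ::
    "nat \<Rightarrow> (nat \<Rightarrow> nat) \<Rightarrow> (nat \<Rightarrow> 'a) set \<Rightarrow> (nat \<Rightarrow> 'a) \<Rightarrow> 'a set \<Rightarrow> bool" where
  "realizes m t F a B \<longleftrightarrow> a \<in> {1..m + 1} \<rightarrow>\<^sub>E S \<and>
     (\<forall>f\<in>F. \<exists>y\<in>B. word_prod mul (interleave m a t f) = Some y)"

lemma k_CR_iff:
  "k_CR S mul k A \<longleftrightarrow> A \<subseteq> S \<and>
     (\<forall>L\<in>\<P>\<^sub>f S. \<exists>r\<ge>1. \<forall>F\<in>\<P>\<^sub>f \<T>. card F \<le> k \<longrightarrow>
        (\<exists>m\<ge>1. \<exists>t. strict_mono_on {1..m} t \<and> t ` {1..m} \<subseteq> {1..r} \<and>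
           (\<exists>a. realizes m t F a (A \<inter> sigma S mul L))))"
proof -
  have "(\<exists>a \<in> {1..m + 1} \<rightarrow>\<^sub>E S. \<exists>t. strict_mono_on {1..m} t \<and> t ` {1..m} \<subseteq> {1..r} \<and>
           (\<forall>f\<in>F. \<exists>y \<in> B. word_prod mul (interleave m a t f) = Some y)) \<longleftrightarrow>
      (\<exists>t. strict_mono_on {1..m} t \<and> t ` {1..m} \<subseteq> {1..r} \<and> (\<exists>a. realizes m t F a B))" for m r F B
    unfolding realizes_def by meson
  then show ?thesis
    unfolding k_CR_def by simp
qed

lemma k_CR_transfer:
  assumes "k_CR S mul k A" "L \<in> \<P>\<^sub>f S"
    and "\<And>m t F a. 1 \<le> m \<Longrightarrow> F \<in> \<P>\<^sub>f \<T> \<Longrightarrow> realizes m t F a (A \<inter> sigma S mul L)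
      \<Longrightarrow> \<exists>a'. realizes m t F a' B"
  shows "\<exists>r\<ge>1. \<forall>F\<in>\<P>\<^sub>f \<T>. card F \<le> k \<longrightarrow>
        (\<exists>m\<ge>1. \<exists>t. strict_mono_on {1..m} t \<and> t ` {1..m} \<subseteq> {1..r} \<and> (\<exists>a. realizes m t F a B))"
proof -
  obtain r where "r \<ge> 1" and r: "\<And>F. F \<in> \<P>\<^sub>f \<T> \<Longrightarrow> card F \<le> k \<Longrightarrow>
        (\<exists>m\<ge>1. \<exists>t. strict_mono_on {1..m} t \<and> t ` {1..m} \<subseteq> {1..r} \<and>
           (\<exists>a. realizes m t F a (A \<inter> sigma S mul L)))"
    using assms(1,2) unfolding k_CR_iff by meson
  show ?thesis
    using \<open>r \<ge> 1\<close> r assms(3) by meson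
qed

section \<open>Absorbing a factor into the last or first letter\<close>

lemma interleave_upd_last:
  "interleave m (a(m + 1 := z)) t f = concat (map (\<lambda>i. [a i, f (t i)]) [1..<m + 1]) @ [z]"
  by (auto simp: interleave_def intro!: arg_cong[of _ _ concat])

lemma interleave_upd_first:
  assumes "1 \<le> m"
  obtains ws where "\<And>z. interleave m (a(1 := z)) t f = z # ws"
proof
  fix z
  have upt: "[1..<m + 1] = 1 # [2..<m + 1]"
    using assms by (simp add: upt_conv_Cons numeral_2_eq_2)
  have tail: "map (\<lambda>i. [(a(1 := z)) i, f (t i)]) [2..<m + 1] = map (\<lambda>i. [a i, f (t i)]) [2..<m + 1]"
    by (rule map_cong) auto
  show "interleave m (a(1 := z)) t f
      = z # f (t 1) # concat (map (\<lambda>i. [a i, f (t i)]) [2..<m + 1]) @ [a (m + 1)]"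
    using assms unfolding interleave_def upt list.map tail by simp
qed

text \<open>The words for all \<open>f\<close> share the last letter \<open>a (m + 1)\<close>, so a
  single replacement by its product with \<open>y\<close> serves them simultaneously. Definedness of
  that product comes from any one \<open>f\<close> in \<open>F\<close>.\<close>

lemma realizes_mul_right:
  assumes "realizes m t F a B" "F \<noteq> {}"
    and "\<And>f w. f \<in> F \<Longrightarrow> word_prod mul (interleave m a t f) = Some w
      \<Longrightarrow> \<exists>z\<in>C. mul w y = Some z"
  shows "\<exists>a'. realizes m t F a' C"
proof -
  have *: "\<exists>zy. mul (a (m + 1)) y = Some zy \<and>
      (\<exists>z\<in>C. word_prod mul (interleave m (a(m + 1 := zy)) t f) = Some z)" if f: "f \<in> F" for f
  proof -
    obtain w where w: "word_prod mul (interleave m a t f) = Some w"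
      using assms(1) f by (auto simp: realizes_def)
    obtain z where z: "z \<in> C" "mul w y = Some z"
      using assms(3)[OF f w] by blast
    show ?thesis
      unfolding interleave_upd_last
      using word_prod_mul_right[OF w[unfolded interleave_def] z(2)] z(1) by blast
  qed
  then obtain zy where zy: "mul (a (m + 1)) y = Some zy"
    using assms(2) by blast
  have "a(m + 1 := zy) \<in> {1..m + 1} \<rightarrow>\<^sub>E S"
    using assms(1) mul_closed(3)[OF zy] by (auto simp: realizes_def PiE_iff extensional_def)
  then have "realizes m t F (a(m + 1 := zy)) C"
    unfolding realizes_def using * zy by fastforce
  then show ?thesis by blast
qed

lemma realizes_mul_left:
  assumes "realizes m t F a B" "F \<noteq> {}" "1 \<le> m"
    and "\<And>w. w \<in> B \<Longrightarrow> \<exists>z\<in>C. mul y w = Some z"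
  shows "\<exists>a'. realizes m t F a' C"
proof -
  have *: "\<exists>yz. mul y (a 1) = Some yz \<and>
      (\<exists>z\<in>C. word_prod mul (interleave m (a(1 := yz)) t f) = Some z)" if f: "f \<in> F" for f
  proof -
    obtain w where w: "word_prod mul (interleave m a t f) = Some w" "w \<in> B"
      using assms(1) f by (auto simp: realizes_def)
    obtain z where z: "z \<in> C" "mul y w = Some z"
      using assms(4)[OF w(2)] by blast
    obtain ws where ws: "\<And>z. interleave m (a(1 := z)) t f = z # ws"
      using interleave_upd_first[OF assms(3)] by blast
    have "word_prod mul (a 1 # ws) = Some w"
      using w(1) ws[of "a 1"] by simp
    then show ?thesis
      unfolding ws using word_prod_mul_left[OF _ z(2)] z(1) by blast
  qed
  then obtain yz where yz: "mul y (a 1) = Some yz"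
    using assms(2) by blast
  have "a(1 := yz) \<in> {1..m + 1} \<rightarrow>\<^sub>E S"
    using assms(1) mul_closed(3)[OF yz] by (auto simp: realizes_def PiE_iff extensional_def)
  then have "realizes m t F (a(1 := yz)) C"
    unfolding realizes_def using * yz by fastforce
  then show ?thesis by blast
qed

text \<open>For each \<open>f\<close>, the \<open>y\<close> that send the value of its word into
  \<open>A\<close> form a member of \<open>q\<close>. As \<open>F\<close> is finite, a common
  \<open>y\<close> exists, and it is absorbed into the last letter.\<close>

lemma k_CR_if_pull:
  assumes q: "q \<in> \<delta>" and A: "A \<subseteq> S" and k: "k_CR S mul k (pull q A)"
  shows "k_CR S mul k A"
  unfolding k_CR_iff
proof (intro conjI ballI)
  fix L assume L: "L \<in> \<P>\<^sub>f S"
  note qb = delta_beta[OF q]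
  show "\<exists>r\<ge>1. \<forall>F\<in>\<P>\<^sub>f \<T>. card F \<le> k \<longrightarrow>
        (\<exists>m\<ge>1. \<exists>t. strict_mono_on {1..m} t \<and> t ` {1..m} \<subseteq> {1..r} \<and>
           (\<exists>a. realizes m t F a (A \<inter> sigma S mul L)))"
  proof (rule k_CR_transfer[OF k L])
    fix m t F a
    assume F: "F \<in> \<P>\<^sub>f \<T>" and a: "realizes m t F a (pull q A \<inter> sigma S mul L)"
    define w where "w f = the (word_prod mul (interleave m a t f))" for f
    have w: "w f \<in> pull q A" "w f \<in> sigma S mul L"
      "word_prod mul (interleave m a t f) = Some (w f)" if "f \<in> F" for f
      using a that by (auto simp: realizes_def w_def)
    \<comment> \<open>The second set keeps the product with \<open>y\<close> inside
      \<open>sigma S mul L\<close>, by \<open>mul_sigma\<close>.\<close>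
    define X where "X f = quot (w f) A \<inter> sigma S mul ((\<lambda>l. the (mul l (w f))) ` L)" for f
    have "X f \<in> q" if "f \<in> F" for f
      unfolding X_def
      using w[OF that] beta_Int[OF qb] delta_sigma[OF q translate_in_Pf[OF L w(2)[OF that]]]
      by (auto simp: pull_def)
    then have "S \<inter> \<Inter>(X ` F) \<in> q"
      using F by (intro beta_Inter[OF qb]) (auto simp: finite_nonempty_subsets_def)
    then have "S \<inter> \<Inter>(X ` F) \<noteq> {}"
      using beta_not_empty[OF qb] by metis
    then obtain y where y: "\<And>f. f \<in> F \<Longrightarrow> y \<in> X f"
      by blast
    show "\<exists>a'. realizes m t F a' (A \<inter> sigma S mul L)"
    proof (rule realizes_mul_right[OF a, of _ y])
      show "F \<noteq> {}" using F by (simp add: finite_nonempty_subsets_def)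
      fix f v assume f: "f \<in> F" "word_prod mul (interleave m a t f) = Some v"
      then have v: "v = w f" using w(3) by simp
      obtain z where "z \<in> A" "mul v y = Some z"
        using y[OF f(1)] by (auto simp: X_def quot_iff v)
      then show "\<exists>z\<in>A \<inter> sigma S mul L. mul v y = Some z"
        using mul_sigma[OF L w(2)[OF f(1)], of y z] y[OF f(1)] by (auto simp: X_def v)
    qed
  qed
qed (fact A)

text \<open>Here \<open>x\<close> depends on \<open>L\<close> alone, so it is fixed before the bound
  \<open>r\<close>. The hypothesis on \<open>quot x A\<close> is applied to the translate of
  \<open>L\<close> by \<open>x\<close>, and \<open>x\<close> is absorbed into the first
  letter.\<close>

lemma k_CR_if_quot:
  assumes A: "A \<subseteq> S" and quot: "\<And>L. L \<in> \<P>\<^sub>f S \<Longrightarrow> \<exists>x\<in>sigma S mul L. k_CR S mul k (quot x A)"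
  shows "k_CR S mul k A"
  unfolding k_CR_iff
proof (intro conjI ballI)
  fix L assume L: "L \<in> \<P>\<^sub>f S"
  obtain x where x: "x \<in> sigma S mul L" "k_CR S mul k (quot x A)"
    using quot[OF L] by blast
  show "\<exists>r\<ge>1. \<forall>F\<in>\<P>\<^sub>f \<T>. card F \<le> k \<longrightarrow>
        (\<exists>m\<ge>1. \<exists>t. strict_mono_on {1..m} t \<and> t ` {1..m} \<subseteq> {1..r} \<and>
           (\<exists>a. realizes m t F a (A \<inter> sigma S mul L)))"
  proof (rule k_CR_transfer[OF x(2) translate_in_Pf[OF L x(1)]])
    fix m t F a
    assume m: "1 \<le> m" and F: "F \<in> \<P>\<^sub>f \<T>"
      and a: "realizes m t F a (quot x A \<inter> sigma S mul ((\<lambda>l. the (mul l x)) ` L))"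
    show "\<exists>a'. realizes m t F a' (A \<inter> sigma S mul L)"
    proof (rule realizes_mul_left[OF a _ m, of _ x])
      show "F \<noteq> {}" using F by (simp add: finite_nonempty_subsets_def)
      fix w assume "w \<in> quot x A \<inter> sigma S mul ((\<lambda>l. the (mul l x)) ` L)"
      then show "\<exists>z\<in>A \<inter> sigma S mul L. mul x w = Some z"
        using mul_sigma[OF L x(1)] by (auto simp: quot_iff)
    qed
  qed
qed (fact A)

section \<open>The ideal of CR ultrafilters and partition regularity\<close>

lemma two_sided_ideal_CR:
  assumes "CR S mul \<noteq> {}"
  shows "two_sided_ideal S mul (CR S mul)"
  unfolding two_sided_ideal_def
proof (intro conjI ballI)
  show "CR S mul \<subseteq> \<delta>" by (auto simp: CR_def)
  fix q p assume q: "q \<in> \<delta>" and "p \<in> CR S mul"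
  then have p: "p \<in> \<delta>" "\<And>A k. A \<in> p \<Longrightarrow> 1 \<le> k \<Longrightarrow> k_CR S mul k A"
    by (auto simp: CR_def CR_set_def)
  have "k_CR S mul k A" if A: "A \<in> q \<star> p" and k: "1 \<le> k" for A k
  proof (rule k_CR_if_quot)
    show "A \<subseteq> S" using A by (simp add: in_conv_iff)
    fix L assume "L \<in> \<P>\<^sub>f S"
    \<comment> \<open>Any element \<open>x\<close> of this set is admissible for \<open>L\<close>
      and has \<open>quot x A\<close> in \<open>p\<close>, so that quotient is
      \<open>k\<close>-CR.\<close>
    then have "sigma S mul L \<inter> pull p A \<in> q"
      using A delta_sigma[OF q] beta_Int[OF delta_beta[OF q]] by (auto simp: in_conv_iff)
    then have "sigma S mul L \<inter> pull p A \<noteq> {}"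
      using beta_not_empty[OF delta_beta[OF q]] by metis
    then show "\<exists>x\<in>sigma S mul L. k_CR S mul k (quot x A)"
      using p(2)[OF _ k] by (auto simp: pull_def)
  qed
  then show "q \<star> p \<in> CR S mul"
    using conv_delta[OF q p(1)] by (simp add: CR_def CR_set_def)
  have "k_CR S mul k A" if "A \<in> p \<star> q" "1 \<le> k" for A k
    using that p(2) k_CR_if_pull[OF q] by (auto simp: in_conv_iff)
  then show "p \<star> q \<in> CR S mul"
    using conv_delta[OF p(1) q] by (simp add: CR_def CR_set_def)
qed (fact assms)

lemma CR_nonempty_iff_piecewise_syndetic_CR:
  "CR S mul \<noteq> {} \<longleftrightarrow> (\<forall>A. piecewise_syndetic S mul A \<longrightarrow> CR_set S mul A)"
proof
  assume "CR S mul \<noteq> {}"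
  then have "K_delta S mul \<subseteq> CR S mul"
    by (intro K_delta_least two_sided_ideal_CR)
  then show "\<forall>A. piecewise_syndetic S mul A \<longrightarrow> CR_set S mul A"
    by (auto simp: piecewise_syndetic_def beta_closure_def CR_def)
next
  assume ps: "\<forall>A. piecewise_syndetic S mul A \<longrightarrow> CR_set S mul A"
  obtain p where p: "p \<in> K_delta S mul" "p \<in> \<delta>"
    using two_sided_ideal_K by (auto simp: two_sided_ideal_def)
  have "piecewise_syndetic S mul A" if "A \<in> p" for A
    using that p beta_subset[OF delta_beta[OF p(2)] that] delta_beta[OF p(2)]
    by (auto simp: piecewise_syndetic_def beta_closure_def)
  then show "CR S mul \<noteq> {}"
    using p(2) ps by (auto simp: CR_def)
qed

text \<open>An ultrafilter containing every set with non-CR complement has only CR members.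
  Partition regularity closes this family under intersection, and the CR property of
  \<open>S\<close> keeps the empty set out.\<close>

lemma CR_nonempty_if_partition_regular:
  assumes S: "CR_set S mul S"
    and part: "\<And>A B. A \<subseteq> S \<Longrightarrow> B \<subseteq> S \<Longrightarrow> CR_set S mul (A \<union> B) \<Longrightarrow> CR_set S mul A \<or> CR_set S mul B"
  shows "CR S mul \<noteq> {}"
proof (cases "\<T> = {}")
  case True
  \<comment> \<open>Without adequate sequences every subset is vacuously a CR set, even \<open>\<emptyset>\<close>.\<close>
  have "CR_set S mul A" if "A \<subseteq> S" for A
    using that True by (auto simp: CR_set_def k_CR_iff finite_nonempty_subsets_def)
  then have "CR S mul = \<delta>"
    using beta_subset[OF delta_beta] unfolding CR_def by auto
  then show ?thesis using delta_nonempty by simp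
next
  case False
  then obtain f where f: "f \<in> \<T>" by blast
  \<comment> \<open>A word for the single sequence \<open>f\<close>, tested against the same
    \<open>L\<close>, would have its value both outside and inside \<open>sigma S mul L\<close>.
    This places the \<open>sigma\<close> sets in \<open>?G\<close> and hence the ultrafilter in
    \<open>\<delta>\<close>.\<close>
  have nCR: "\<not> CR_set S mul (S - sigma S mul L)" if L: "L \<in> \<P>\<^sub>f S" for L
  proof
    assume "CR_set S mul (S - sigma S mul L)"
    then have "k_CR S mul 1 (S - sigma S mul L)" by (simp add: CR_set_def)
    then obtain r where r: "\<And>F. F \<in> \<P>\<^sub>f \<T> \<Longrightarrow> card F \<le> 1 \<Longrightarrow>
        \<exists>m t a. realizes m t F a ((S - sigma S mul L) \<inter> sigma S mul L)"
      using L unfolding k_CR_iff by meson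
    then show False
      using r[of "{f}"] f by (auto simp: realizes_def finite_nonempty_subsets_def)
  qed
  let ?G = "{A. A \<subseteq> S \<and> \<not> CR_set S mul (S - A)}"
  have "fip S ?G"
  proof (rule fipI)
    show "{} \<notin> ?G" using S by simp
    show "?G \<noteq> {}"
      using P\<^sub>f_nonempty nCR sigma_subset by blast
    show "A \<inter> B \<in> ?G" if "A \<in> ?G" "B \<in> ?G" for A B
      using that part[of "S - A" "S - B"] by (auto simp: Diff_Int)
  qed blast
  then obtain p where p: "p \<in> beta S" "?G \<subseteq> p" by (rule ultrafilter_exists)
  have "sigma S mul L \<in> p" if "L \<in> \<P>\<^sub>f S" for L
    using nCR[OF that] sigma_subset[OF that] p(2) by blast
  moreover have "CR_set S mul A" if "A \<in> p" for A
  proof (rule ccontr)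
    have A: "A \<subseteq> S" using beta_subset[OF p(1) that] .
    assume "\<not> CR_set S mul A"
    then have "S - A \<in> ?G" using A by (simp add: double_diff)
    then show False
      using p(2) beta_Compl_iff[OF p(1) A] that by blast
  qed
  ultimately show ?thesis
    using p(1) by (auto simp: CR_def in_delta_iff)
qed

end

theorem theorem3p11:
  fixes S :: "'a set" and mul :: "'a \<Rightarrow> 'a \<Rightarrow> 'a option"
  assumes "adequate_partial_semigroup S mul"
  shows "(CR S mul \<noteq> {} \<longleftrightarrow> (\<forall>A. piecewise_syndetic S mul A \<longrightarrow> CR_set S mul A))
    \<and> ((\<forall>A. piecewise_syndetic S mul A \<longrightarrow> CR_set S mul A) \<longleftrightarrow>
       (\<forall>k\<ge>1. \<forall>A. piecewise_syndetic S mul A \<longrightarrow> k_CR S mul k A))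
    \<and> (CR_set S mul S \<and>
       (\<forall>A1 A2. A1 \<subseteq> S \<and> A2 \<subseteq> S \<and> CR_set S mul (A1 \<union> A2) \<longrightarrow>
          CR_set S mul A1 \<or> CR_set S mul A2)
       \<longrightarrow> CR S mul \<noteq> {})"
proof -
  interpret adequate_psg S mul
    by unfold_locales (fact assms)
  show ?thesis
  proof (intro conjI impI)
    show "CR S mul \<noteq> {} \<longleftrightarrow> (\<forall>A. piecewise_syndetic S mul A \<longrightarrow> CR_set S mul A)"
      by (fact CR_nonempty_iff_piecewise_syndetic_CR)
    show "(\<forall>A. piecewise_syndetic S mul A \<longrightarrow> CR_set S mul A) \<longleftrightarrow>
       (\<forall>k\<ge>1. \<forall>A. piecewise_syndetic S mul A \<longrightarrow> k_CR S mul k A)"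
      unfolding CR_set_def by blast
    show "CR S mul \<noteq> {}" if "CR_set S mul S \<and>
       (\<forall>A1 A2. A1 \<subseteq> S \<and> A2 \<subseteq> S \<and> CR_set S mul (A1 \<union> A2) \<longrightarrow>
          CR_set S mul A1 \<or> CR_set S mul A2)"
      by (rule CR_nonempty_if_partition_regular) (use that in simp_all)
  qed
qed

end
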